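(* Let $X(t)$ be the exact solution on $[t_0,T_f]$ of $\dot X(t)=AX(t)+X(t)B+EF^T$, $X(t_0)=0$, and let $X_m(t)=\mathcal{V}_mG_m(t)\mathcal{W}_m^T$ be the approximate solution obtained at step $m$ of the extended block Arnoldi (or block Arnoldi) process. Then the error $\mathcal{E}_m(t)=X(t)-X_m(t)$ satisfies, for $t\in[t_0,T_f]$, $$\|\mathcal{E}_m(t)\|\le\|F\|\,e^{t\mu_2(B)}\,\Gamma_{1,m}(t)+\|E_m\|\,e^{t\mu_2(A)}\,\Gamma_{2,m}(t),$$ where $$\Gamma_{1,m}(t)=\int_{t_0}^t e^{-\tau\mu_2(B)}\,\|Z_A(\tau)-Z_{m,A}(\tau)\|\,d\tau,\qquad \Gamma_{2,m}(t)=\int_{t_0}^t e^{-\tau\mu_2(A)}\,\|Z_B(\tau)-Z_{m,B}(\tau)\|\,d\tau,$$ and, for the given $t$, $Z_A(\tau)=e^{(t-\tau)A}E$, $Z_B(\tau)=e^{(t-\tau)B^T}F$, $Z_{m,A}(\tau)=\mathcal{V}_me^{(t-\tau)\mathcal{T}_{m,A}}E_m$, $Z_{m,B}(\tau)=\mathcal{W}_me^{(t-\tau)\mathcal{T}_{m,B}}F_m$.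
   Context: $\|\cdot\|$ is the (spectral) 2-norm. For a real square matrix $M$, the 2-logarithmic norm is $\mu_2(M)=\lim_{h\to0^+}\frac{\|I+hM\|-1}{h}=\frac12\lambda_{\max}(M+M^T)$. Let $A\in\mathbb{R}^{n\times n}$ and $B\in\mathbb{R}^{p\times p}$ be constant matrices, and let $E\in\mathbb{R}^{n\times s}$, $F\in\mathbb{R}^{p\times s}$ be constant full rank matrices. Let $t_0<T_f$ be real numbers and $m\ge 1$ an integer. Krylov subspaces. Two cases are treated simultaneously. In the block Krylov case put $d=s$, $\mathcal{K}_j(A,E)=\mathrm{range}(E,AE,\ldots,A^{j-1}E)$ and $\mathcal{K}_j(B^T,F)=\mathrm{range}(F,B^TF,\ldots,(B^T)^{j-1}F)$. In the extended block Krylov case ($A$, $B$ nonsingular) put $d=2s$, $\mathcal{K}_j(A,E)=\mathrm{range}(A^{-j}E,\ldots,A^{-1}E,E,AE,\ldots,A^{j-1}E)$ and likewise $\mathcal{K}_j(B^T,F)$ with $(A,E)$ replaced by $(B^T,F)$. The (extended) block Arnoldi algorithm applied to $(A,E)$ and $(B^T,F)$ is assumed not to break down. It produces blocks $V_1,V_2,\ldots\in\mathbb{R}^{n\times d}$ and $W_1,W_2,\ldots\in\mathbb{R}^{p\times d}$ such that, for each $j\le m$, the columns of $\mathcal{V}_j=[V_1,\ldots,V_j]$ form an orthonormal basis of $\mathcal{K}_j(A,E)$ and the columns of $\mathcal{W}_j=[W_1,\ldots,W_j]$ form an orthonormal basis of $\mathcal{K}_j(B^T,F)$. Put $\mathcal{T}_{m,A}=\mathcal{V}_m^TA\mathcal{V}_m$,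 $\mathcal{T}_{m,B}=\mathcal{W}_m^TB^T\mathcal{W}_m$, $E_m=\mathcal{V}_m^TE$, $F_m=\mathcal{W}_m^TF$. The $md\times md$ matrix function $G_m$ is $$G_m(t)=\int_{t_0}^{t} e^{(t-\tau)\mathcal{T}_{m,A}}\,E_m\,F_m^T\,e^{(t-\tau)\mathcal{T}_{m,B}^T}\,d\tau,$$ which satisfies $\dot G_m=\mathcal{T}_{m,A}G_m+G_m\mathcal{T}_{m,B}^T+E_mF_m^T$ on $[t_0,T_f]$. *)

theory Defs
  imports "HOL-Analysis.Analysis"
begin

text \<open>
  An \<open>n \<times> p\<close> real matrix has type \<open>real ^ 'p ^ 'n\<close>. On this type the class operations
  \<open>*\<close>, \<open>1\<close>, \<open>^\<close> act entrywise (and there is no \<open>exp\<close>), and \<open>norm\<close> is the Frobenius norm.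
  Matrix powers, the matrix exponential and the spectral norm are therefore
  introduced explicitly.
\<close>

definition spec_norm :: "real ^ 'p ^ 'n \<Rightarrow> real" where
  "spec_norm M = onorm ((*v) M)"

primrec mpow :: "real ^ 'n ^ 'n \<Rightarrow> nat \<Rightarrow> real ^ 'n ^ 'n" where
  "mpow M 0 = mat 1"
| "mpow M (Suc k) = M ** mpow M k"

definition mexp :: "real ^ 'n ^ 'n \<Rightarrow> real ^ 'n ^ 'n" where
  "mexp M = (\<Sum>k. (1 / fact k) *\<^sub>R mpow M k)"

text \<open>
  The 2-logarithmic norm. The difference quotient is nondecreasing in \<open>h > 0\<close>
  (convexity of the norm) and bounded below by \<open>- spec_norm M\<close>, so the limit exists.
\<close>

definition log_norm2 :: "real ^ 'n ^ 'n \<Rightarrow> real" where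
  "log_norm2 M = Lim (at_right 0) (\<lambda>h. (spec_norm (mat 1 + h *\<^sub>R M) - 1) / h)"

definition full_rank :: "real ^ 's ^ 'n \<Rightarrow> bool" where
  "full_rank M \<longleftrightarrow> rank M = min CARD('n) CARD('s)"

text \<open>
  The range of a block row \<open>(M\<^sub>1, \<dots>, M\<^sub>k)\<close> is the span of all columns of its blocks.
\<close>

definition block_krylov :: "real ^ 'n ^ 'n \<Rightarrow> real ^ 's ^ 'n \<Rightarrow> nat \<Rightarrow> (real ^ 'n) set" where
  "block_krylov A E j = span (\<Union>i<j. columns (mpow A i ** E))"

definition ext_block_krylov :: "real ^ 'n ^ 'n \<Rightarrow> real ^ 's ^ 'n \<Rightarrow> nat \<Rightarrow> (real ^ 'n) set" where
  "ext_block_krylov A E j =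
     span ((\<Union>i\<in>{1..j}. columns (mpow (matrix_inv A) i ** E)) \<union> (\<Union>i<j. columns (mpow A i ** E)))"

text \<open>
  The columns of \<open>[V 1, \<dots>, V j]\<close>, as a family indexed by block number and position
  inside the block, form an orthonormal basis of the subspace \<open>K\<close>.
\<close>

definition orthonormal_block_basis ::
    "(nat \<Rightarrow> real ^ 'd ^ 'n) \<Rightarrow> nat \<Rightarrow> (real ^ 'n) set \<Rightarrow> bool" where
  "orthonormal_block_basis V j K \<longleftrightarrow>
     (\<forall>i\<in>{1..j}. \<forall>k\<in>{1..j}. \<forall>c d.
        column c (V i) \<bullet> column d (V k) = (if i = k \<and> c = d then 1 else 0)) \<and>
     span (\<Union>i\<in>{1..j}. columns (V i)) = K"

text \<open>
  The matrix \<open>[V 1, \<dots>, V m]\<close> with \<open>m = CARD('m)\<close>. Its columns are indexed by pairs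
  (block, column within the block); an element \<open>k\<close> of the ordered index type \<open>'m\<close>
  denotes the block number \<open>card {..k} \<in> {1..m}\<close>.
\<close>

definition block_row :: "(nat \<Rightarrow> real ^ 'd ^ 'n) \<Rightarrow> real ^ ('m::{finite,linorder} \<times> 'd) ^ 'n" where
  "block_row V = (\<chi> i kc. V (card {..fst kc}) $ i $ snd kc)"

end

theory Submission
  imports Defs
begin

text \<open>
  Variation of constants writes the exact solution as the integral over \<open>{t0..t}\<close> of
  \<open>ZA t s ** transpose (ZB t s)\<close> (lemma \<open>differential_sylvester_solution\<close>). The projected
  approximation is by construction the same integral with \<open>ZmA\<close>, \<open>ZmB\<close> in place of \<open>ZA\<close>,
  \<open>ZB\<close>. Hence the error is the integral of
  \<open>(ZA - ZmA) ** transpose ZB + ZmA ** transpose (ZB - ZmB)\<close>, and the two summands give the two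
  terms of the bound as soon as the other factor of each is under control: \<open>ZB t s\<close> by
  \<open>e\<^bsup>(t-s)\<mu>(B)\<^esup> \<parallel>F\<parallel>\<close> and \<open>ZmA t s\<close> by \<open>e\<^bsup>(t-s)\<mu>(A)\<^esup> \<parallel>Em\<parallel>\<close>.

  Both estimates are instances of one energy argument (lemma \<open>spec_norm_mexp_le\<close>): a bound
  \<open>x \<bullet> M x \<le> c \<parallel>x\<parallel>\<^sup>2\<close> on the quadratic form forces \<open>\<parallel>e\<^bsup>sM\<^esup>\<parallel> \<le> e\<^bsup>sc\<^esup>\<close> for \<open>s \<ge> 0\<close>. The
  logarithmic norm is such a constant \<open>c\<close> (lemma \<open>inner_le_log_norm2\<close>). The columns of \<open>VV\<close>
  are orthonormal, so \<open>VV\<close> is isometric and the compression \<open>TA\<close> inherits the constant of \<open>A\<close>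
  through \<open>y \<bullet> TA y = VV y \<bullet> A (VV y)\<close>. The exponentials of \<open>B\<close> and of its transpose have equal
  norm, which is why \<open>\<mu>(B)\<close> governs \<open>ZB\<close>.
\<close>

section \<open>Matrix products as bounded bilinear maps\<close>

lemma bounded_bilinear_matrix_mult:
  "bounded_bilinear ((**) :: real ^ 'm ^ 'n \<Rightarrow> real ^ 'p ^ 'm \<Rightarrow> real ^ 'p ^ 'n)"
  unfolding bilinear_conv_bounded_bilinear[symmetric] bilinear_def
  by (auto intro!: linearI
      simp: matrix_add_ldistrib matrix_matrix_mult_def vec_eq_iff algebra_simps sum.distrib sum_distrib_left)

lemma bounded_bilinear_matrix_vector_mult:
  "bounded_bilinear ((*v) :: real ^ 'm ^ 'n \<Rightarrow> real ^ 'm \<Rightarrow> real ^ 'n)"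
  unfolding bilinear_conv_bounded_bilinear[symmetric] bilinear_def
  by (auto intro!: linearI
      simp: matrix_vector_mult_def vec_eq_iff algebra_simps sum.distrib sum_distrib_left)

lemma bounded_linear_transpose: "bounded_linear (transpose :: real ^ 'm ^ 'n \<Rightarrow> real ^ 'n ^ 'm)"
  by (auto intro!: linearI linear_conv_bounded_linear[THEN iffD1] simp: transpose_def vec_eq_iff)

lemmas matrix_mult_diff_left = bounded_bilinear.diff_left[OF bounded_bilinear_matrix_mult]
lemmas matrix_mult_diff_right = bounded_bilinear.diff_right[OF bounded_bilinear_matrix_mult]
lemmas matrix_mult_scaleR_right = bounded_bilinear.scaleR_right[OF bounded_bilinear_matrix_mult]
lemmas matrix_mult_scaleR_left = bounded_bilinear.scaleR_left[OF bounded_bilinear_matrix_mult]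
lemmas continuous_on_matrix_mult =
  bounded_bilinear.continuous_on[OF bounded_bilinear_matrix_mult]
lemmas continuous_on_transpose = bounded_linear.continuous_on[OF bounded_linear_transpose]

lemma inner_transpose_vector: "(transpose M *v x) \<bullet> y = x \<bullet> (M *v y)"
  for M :: "real ^ 'm ^ 'n"
  by (simp add: dot_lmul_matrix)

section \<open>The spectral norm\<close>

lemma norm_le_spec_norm: "norm (M *v x) \<le> spec_norm M * norm x"
  unfolding spec_norm_def by (rule onorm) simp

lemma spec_norm_nonneg: "0 \<le> spec_norm M"
  unfolding spec_norm_def by (rule onorm_pos_le) simp

lemma spec_norm_leI: "0 \<le> b \<Longrightarrow> (\<And>x. norm (M *v x) \<le> b * norm x) \<Longrightarrow> spec_norm M \<le> b"
  unfolding spec_norm_def by (rule onorm_bound)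

lemma spec_norm_mat_1: "spec_norm (mat 1 :: real ^ 'n ^ 'n) = 1"
proof -
  have "(*v) (mat 1 :: real ^ 'n ^ 'n) = (\<lambda>x. x)" by auto
  then show ?thesis unfolding spec_norm_def by (simp only: onorm_id)
qed

lemma spec_norm_add: "spec_norm (M + N) \<le> spec_norm M + spec_norm N"
  unfolding spec_norm_def matrix_vector_mult_add_rdistrib by (rule onorm_triangle) simp_all

lemma spec_norm_scaleR: "spec_norm (r *\<^sub>R M) = \<bar>r\<bar> * spec_norm M"
  unfolding spec_norm_def scaleR_matrix_vector_assoc[symmetric] by (rule onorm_scaleR) simp

lemma spec_norm_mult: "spec_norm (M ** N) \<le> spec_norm M * spec_norm N"
  unfolding spec_norm_def
  using onorm_compose[of "(*v) M" "(*v) N"] by (simp add: o_def matrix_vector_mul_assoc)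

text \<open>
  By the Cauchy--Schwarz inequality \<open>\<parallel>M\<^sup>T x\<parallel>\<^sup>2 = x \<bullet> M (M\<^sup>T x) \<le> \<parallel>x\<parallel> \<parallel>M\<parallel> \<parallel>M\<^sup>T x\<parallel>\<close>; now cancel
  \<open>\<parallel>M\<^sup>T x\<parallel>\<close>.
\<close>

lemma spec_norm_transpose_le: "spec_norm (transpose M) \<le> spec_norm M"
proof (rule spec_norm_leI[OF spec_norm_nonneg])
  fix x
  have "norm (transpose M *v x) ^ 2 = x \<bullet> (M *v (transpose M *v x))"
    by (simp only: power2_norm_eq_inner inner_transpose_vector)
  also have "\<dots> \<le> norm x * (spec_norm M * norm (transpose M *v x))"
    using norm_cauchy_schwarz mult_left_mono[OF norm_le_spec_norm norm_ge_zero] by (rule order_trans)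
  finally have "norm (transpose M *v x) * norm (transpose M *v x)
      \<le> (spec_norm M * norm x) * norm (transpose M *v x)"
    by (simp add: power2_eq_square algebra_simps)
  then show "norm (transpose M *v x) \<le> spec_norm M * norm x"
    by (metis mult_le_cancel_right norm_ge_zero not_le order_antisym mult_nonneg_nonneg spec_norm_nonneg)
qed

lemma spec_norm_transpose: "spec_norm (transpose M) = spec_norm M"
  using spec_norm_transpose_le[of M] spec_norm_transpose_le[of "transpose M"] by simp

text \<open>
  The spectral norm is dominated by a multiple \<open>K\<close> of the Frobenius norm, which defines the
  topology on matrices; with the triangle inequality it is therefore Lipschitz.
\<close>

lemma continuous_on_spec_norm:
  fixes f :: "'a::topological_space \<Rightarrow> real ^ 'm ^ 'n"
  assumes "continuous_on S f"
  shows "continuous_on S (\<lambda>x. spec_norm (f x))"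
proof -
  obtain K where K: "\<And>M (x :: real ^ 'm). norm ((M :: real ^ 'm ^ 'n) *v x) \<le> norm M * norm x * K" "0 \<le> K"
    using bounded_bilinear.nonneg_bounded[OF bounded_bilinear_matrix_vector_mult] by blast
  have le: "spec_norm M \<le> K * norm M" for M :: "real ^ 'm ^ 'n"
    using K by (intro spec_norm_leI) (auto simp: algebra_simps)
  have "K-lipschitz_on UNIV (spec_norm :: real ^ 'm ^ 'n \<Rightarrow> real)"
  proof (rule lipschitz_onI[OF _ K(2)])
    fix M N :: "real ^ 'm ^ 'n"
    have "spec_norm M \<le> spec_norm N + K * norm (M - N)" for M N :: "real ^ 'm ^ 'n"
      using spec_norm_add[of "M - N" N] le[of "M - N"] by simp
    from this[of M N] this[of N M] show "dist (spec_norm M) (spec_norm N) \<le> K * dist M N"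
      by (simp add: dist_norm norm_minus_commute abs_le_iff)
  qed
  then have "continuous_on UNIV (spec_norm :: real ^ 'm ^ 'n \<Rightarrow> real)"
    by (rule lipschitz_on_continuous_on)
  from continuous_on_compose2[OF this assms] show ?thesis by simp
qed

text \<open>
  The norm inequality for integrals refers to the Frobenius norm of the type. For the
  spectral norm it is obtained by applying the vector version to \<open>s \<mapsto> f s x\<close> for every
  vector \<open>x\<close>.
\<close>

lemma spec_norm_integral_le:
  fixes f :: "real \<Rightarrow> real ^ 'm ^ 'n"
  assumes f: "continuous_on {a..b} f" and g: "continuous_on {a..b} g"
    and le: "\<And>s. s \<in> {a..b} \<Longrightarrow> spec_norm (f s) \<le> g s"
  shows "spec_norm (integral {a..b} f) \<le> integral {a..b} g"
proof (rule spec_norm_leI)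
  show "0 \<le> integral {a..b} g"
    using order_trans[OF spec_norm_nonneg le]
    by (intro integral_nonneg integrable_continuous_real g)
  fix x
  have bl: "bounded_linear (\<lambda>M :: real ^ 'm ^ 'n. M *v x)"
    by (rule bounded_bilinear.bounded_linear_left[OF bounded_bilinear_matrix_vector_mult])
  have "integral {a..b} f *v x = integral {a..b} (\<lambda>s. f s *v x)"
    using integral_linear[OF integrable_continuous_real[OF f] bl] by (simp add: o_def)
  also have "norm \<dots> \<le> integral {a..b} (\<lambda>s. g s * norm x)"
  proof (rule integral_norm_bound_integral)
    show "(\<lambda>s. f s *v x) integrable_on {a..b}"
      by (intro integrable_continuous_real bounded_linear.continuous_on[OF bl] f)
    show "(\<lambda>s. g s * norm x) integrable_on {a..b}"
      by (intro integrable_continuous_real continuous_intros g)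
    show "norm (f s *v x) \<le> g s * norm x" if "s \<in> {a..b}" for s
      using norm_le_spec_norm mult_right_mono[OF le[OF that] norm_ge_zero] by (rule order_trans)
  qed
  finally show "norm (integral {a..b} f *v x) \<le> integral {a..b} g * norm x" by simp
qed

section \<open>The matrix exponential\<close>

lemma mpow_scaleR: "mpow (s *\<^sub>R M) k = s ^ k *\<^sub>R mpow M k"
  by (induction k) (simp_all add: matrix_mult_scaleR_left matrix_mult_scaleR_right mult.commute)

lemma mpow_commute: "mpow M k ** M = M ** mpow M k"
  by (induction k) (simp_all add: matrix_mul_assoc[symmetric])

lemma mpow_transpose: "mpow (transpose M) k = transpose (mpow M k)"
  for M :: "real ^ 'n ^ 'n"
  by (induction k) (simp_all add: mpow_commute[symmetric] matrix_transpose_mul)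

text \<open>
  Comparison with the scalar exponential series of \<open>K \<parallel>M\<parallel>\<close>, where \<open>K\<close> bounds the bilinear
  matrix product in the norm of the type.
\<close>

lemma mexp_summable:
  fixes M :: "real ^ 'n ^ 'n"
  shows "summable (\<lambda>k. (1 / fact k) *\<^sub>R mpow M k)"
proof -
  obtain K where K: "\<And>(L :: real ^ 'n ^ 'n) (N :: real ^ 'n ^ 'n). norm (L ** N) \<le> norm L * norm N * K" "0 \<le> K"
    using bounded_bilinear.nonneg_bounded[OF bounded_bilinear_matrix_mult] by blast
  have bound: "norm (mpow M k) \<le> norm (mat 1 :: real ^ 'n ^ 'n) * (norm M * K) ^ k" for k
  proof (induction k)
    case (Suc k)
    have "norm (mpow M (Suc k)) \<le> (norm M * K) * norm (mpow M k)"
      using K(1)[of M "mpow M k"] by (simp add: algebra_simps)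
    also have "\<dots> \<le> (norm M * K) * (norm (mat 1 :: real ^ 'n ^ 'n) * (norm M * K) ^ k)"
      using Suc K(2) by (intro mult_left_mono) auto
    finally show ?case by (simp add: algebra_simps)
  qed simp
  have "summable (\<lambda>k. norm (mat 1 :: real ^ 'n ^ 'n) * (inverse (fact k) * (norm M * K) ^ k))"
    by (intro summable_mult summable_exp)
  then show ?thesis
    by (rule summable_comparison_test'[where N = 0])
       (use bound in \<open>auto simp: field_simps intro!: divide_right_mono\<close>)
qed

lemma mexp_0: "mexp 0 = (mat 1 :: real ^ 'n ^ 'n)"
proof -
  have "(\<lambda>k. (1 / fact k) *\<^sub>R mpow (0 :: real ^ 'n ^ 'n) k) = (\<lambda>k. if k = 0 then mat 1 else 0)"
  proof
    fix k show "(1 / fact k) *\<^sub>R mpow (0 :: real ^ 'n ^ 'n) k = (if k = 0 then mat 1 else 0)"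
      by (cases k) (simp_all add: bounded_bilinear.zero_left[OF bounded_bilinear_matrix_mult])
  qed
  then show ?thesis
    unfolding mexp_def using sums_single[of 0 "\<lambda>_. mat 1 :: real ^ 'n ^ 'n"] by (simp add: sums_iff)
qed

lemma mexp_commute: "mexp M ** M = M ** mexp M"
  unfolding mexp_def
  by (simp add: bounded_linear.suminf[OF bounded_bilinear.bounded_linear_right
          [OF bounded_bilinear_matrix_mult] mexp_summable]
        bounded_linear.suminf[OF bounded_bilinear.bounded_linear_left
          [OF bounded_bilinear_matrix_mult] mexp_summable]
        matrix_mult_scaleR_left matrix_mult_scaleR_right mpow_commute)

lemma mexp_transpose: "mexp (transpose M) = transpose (mexp M)"
  unfolding mexp_def bounded_linear.suminf[OF bounded_linear_transpose mexp_summable]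
  by (simp add: mpow_transpose transpose_scalar)

text \<open>
  Paired with a fixed matrix \<open>b\<close>, the exponential becomes an everywhere convergent real power
  series in \<open>s\<close>, so it may be differentiated termwise; the differentiated coefficients are
  those of \<open>M e\<^bsup>sM\<^esup>\<close>. Letting \<open>b\<close> run through a basis gives the matrix-valued derivative.
\<close>

lemma mexp_has_vector_derivative:
  "((\<lambda>s. mexp (s *\<^sub>R M)) has_vector_derivative M ** mexp (s *\<^sub>R M)) (at s within S)"
  for M :: "real ^ 'n ^ 'n"
proof -
  have "((\<lambda>s. mexp (s *\<^sub>R M) \<bullet> b) has_field_derivative (M ** mexp (s *\<^sub>R M)) \<bullet> b) (at s)" for b
  proof -
    define c where "c k = ((1 / fact k) *\<^sub>R mpow M k) \<bullet> b" for k
    have coeff: "((1 / fact k) *\<^sub>R mpow (y *\<^sub>R M) k) \<bullet> b = c k * y ^ k" for k y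
      by (simp add: c_def mpow_scaleR)
    have "summable (\<lambda>k. c k * y ^ k)" for y
      using bounded_linear.summable[OF bounded_linear_inner_left mexp_summable]
      unfolding coeff[symmetric] .
    from termdiffs_strong_converges_everywhere[OF this]
    have "((\<lambda>y. \<Sum>k. c k * y ^ k) has_field_derivative (\<Sum>k. diffs c k * s ^ k)) (at s)" .
    moreover have "(\<Sum>k. c k * y ^ k) = mexp (y *\<^sub>R M) \<bullet> b" for y
      unfolding mexp_def bounded_linear.suminf[OF bounded_linear_inner_left mexp_summable] coeff ..
    moreover have "(\<Sum>k. diffs c k * s ^ k) = (M ** mexp (s *\<^sub>R M)) \<bullet> b"
    proof -
      have bl: "bounded_linear (\<lambda>N. (M ** N) \<bullet> b)"
        by (rule bounded_linear_compose[OF bounded_linear_inner_left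
              bounded_bilinear.bounded_linear_right[OF bounded_bilinear_matrix_mult]])
      have "(M ** ((1 / fact k) *\<^sub>R mpow (s *\<^sub>R M) k)) \<bullet> b = diffs c k * s ^ k" for k
        by (simp add: diffs_def c_def mpow_scaleR matrix_mult_scaleR_right field_simps del: of_nat_Suc)
      then show ?thesis
        unfolding mexp_def bounded_linear.suminf[OF bl mexp_summable] by simp
    qed
    ultimately show ?thesis by simp
  qed
  moreover have "(*) (D \<bullet> b) = (\<lambda>x. (x *\<^sub>R D) \<bullet> b)" for D b :: "real ^ 'n ^ 'n"
    by (simp add: fun_eq_iff)
  ultimately have "((\<lambda>s. mexp (s *\<^sub>R M) \<bullet> b)
      has_derivative (\<lambda>x. (x *\<^sub>R (M ** mexp (s *\<^sub>R M))) \<bullet> b)) (at s within S)" for b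
    unfolding has_field_derivative_def by (metis has_derivative_at_withinI)
  then show ?thesis
    unfolding has_vector_derivative_def has_derivative_componentwise_within[of "\<lambda>s. mexp (s *\<^sub>R M)"]
    by blast
qed

lemma mexp_reverse_has_vector_derivative:
  "((\<lambda>s. mexp ((t - s) *\<^sub>R M)) has_vector_derivative - (M ** mexp ((t - s) *\<^sub>R M))) (at s within S)"
  for M :: "real ^ 'n ^ 'n"
proof -
  have "((\<lambda>s. t - s) has_real_derivative -1) (at s within S)"
    by (auto intro!: derivative_eq_intros)
  from vector_diff_chain_within[OF this[unfolded has_real_derivative_iff_has_vector_derivative]
      mexp_has_vector_derivative]
  show ?thesis by (simp add: o_def)
qed

lemma continuous_on_mexp_reverse: "continuous_on S (\<lambda>s. mexp ((t - s) *\<^sub>R M))"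
  for M :: "real ^ 'n ^ 'n"
  using mexp_reverse_has_vector_derivative
  by (intro continuous_on_vector_derivative)

text \<open>
  For a trajectory \<open>y' = M y\<close> the energy satisfies \<open>(\<parallel>y\<parallel>\<^sup>2)' = 2 y \<bullet> M y \<le> 2c \<parallel>y\<parallel>\<^sup>2\<close>, so
  \<open>e\<^bsup>-2cr\<^esup> \<parallel>y(r)\<parallel>\<^sup>2\<close> is nonincreasing in \<open>r\<close>.
\<close>

lemma spec_norm_mexp_le:
  fixes M :: "real ^ 'n ^ 'n"
  assumes c: "\<And>x. x \<bullet> (M *v x) \<le> c * (norm x)\<^sup>2" and "0 \<le> s"
  shows "spec_norm (mexp (s *\<^sub>R M)) \<le> exp (s * c)"
proof (rule spec_norm_leI)
  fix x :: "real ^ 'n"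
  define y where "y r = mexp (r *\<^sub>R M) *v x" for r
  define g where "g r = exp (- (2 * c * r)) * (y r \<bullet> y r)" for r
  have dy: "(y has_vector_derivative M *v y r) (at r)" for r
    using bounded_linear.has_vector_derivative[OF bounded_bilinear.bounded_linear_left
        [OF bounded_bilinear_matrix_vector_mult, of x] mexp_has_vector_derivative[of M r UNIV]]
    by (simp add: y_def[abs_def] matrix_vector_mul_assoc)
  have "((\<lambda>r. y r \<bullet> y r) has_real_derivative 2 * (y r \<bullet> (M *v y r))) (at r)" for r
    using bounded_bilinear.has_vector_derivative[OF bounded_bilinear_inner dy dy, of r]
    by (simp add: has_real_derivative_iff_has_vector_derivative inner_commute)
  then have dg: "(g has_real_derivative
      exp (- (2 * c * r)) * (2 * (y r \<bullet> (M *v y r)) - 2 * c * (y r \<bullet> y r))) (at r)" for r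
    unfolding g_def[abs_def] by (auto intro!: derivative_eq_intros simp: algebra_simps)
  have "exp (- (2 * c * r)) * (2 * (y r \<bullet> (M *v y r)) - 2 * c * (y r \<bullet> y r)) \<le> 0" for r
    using c[of "y r"] by (intro mult_nonneg_nonpos) (auto simp: power2_norm_eq_inner)
  then have "g s \<le> g 0"
    using dg by (intro DERIV_nonpos_imp_nonincreasing[OF \<open>0 \<le> s\<close>]) blast
  then have "y s \<bullet> y s \<le> exp (2 * c * s) * (x \<bullet> x)"
    by (simp add: g_def y_def mexp_0 exp_minus field_simps)
  also have "\<dots> = (exp (s * c) * norm x)\<^sup>2"
    by (simp add: power_mult_distrib power2_norm_eq_inner ac_simps flip: exp_of_nat_mult)
  finally show "norm (mexp (s *\<^sub>R M) *v x) \<le> exp (s * c) * norm x"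
    unfolding power2_norm_eq_inner[symmetric] y_def by (rule power2_le_imp_le) simp
qed simp

section \<open>The logarithmic norm\<close>

text \<open>
  The difference quotient \<open>q h\<close> dominates \<open>x \<bullet> M x\<close> for unit vectors \<open>x\<close>, because
  \<open>1 + h (x \<bullet> M x) = x \<bullet> (I + h M) x \<le> \<parallel>I + h M\<parallel>\<close>. It is also nondecreasing in \<open>h > 0\<close>, so that
  its limit at \<open>0\<close> exists and is its infimum over \<open>h > 0\<close>, and the inequality passes to the
  limit.
\<close>

lemma inner_le_log_norm2: "x \<bullet> (M *v x) \<le> log_norm2 M * (norm x)\<^sup>2"
  for M :: "real ^ 'n ^ 'n"
proof -
  define q where "q h = (spec_norm (mat 1 + h *\<^sub>R M) - 1) / h" for h
  have below: "x \<bullet> (M *v x) \<le> q h * (norm x)\<^sup>2" if "0 < h" for h x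
  proof -
    have "x \<bullet> x + h * (x \<bullet> (M *v x)) = x \<bullet> ((mat 1 + h *\<^sub>R M) *v x)"
      by (simp add: matrix_vector_mult_add_rdistrib scaleR_matrix_vector_assoc[symmetric] inner_right_distrib)
    also have "\<dots> \<le> norm x * (spec_norm (mat 1 + h *\<^sub>R M) * norm x)"
      using norm_cauchy_schwarz mult_left_mono[OF norm_le_spec_norm norm_ge_zero] by (rule order_trans)
    finally have "h * (x \<bullet> (M *v x)) \<le> (spec_norm (mat 1 + h *\<^sub>R M) - 1) * (norm x)\<^sup>2"
      by (simp add: power2_norm_eq_inner[symmetric] power2_eq_square algebra_simps)
    then show ?thesis using that by (simp add: q_def field_simps)
  qed
  have mono: "q h \<le> q k" if "0 < h" "h \<le> k" for h k
  proof -
    \<comment> \<open>\<open>I + hM\<close> lies on the segment from \<open>I\<close>, which has norm 1, to \<open>I + kM\<close>.\<close>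
    have "mat 1 + h *\<^sub>R M = (1 - h / k) *\<^sub>R mat 1 + (h / k) *\<^sub>R (mat 1 + k *\<^sub>R M)"
      using that by (simp add: algebra_simps)
    then have "spec_norm (mat 1 + h *\<^sub>R M) \<le> (1 - h / k) + (h / k) * spec_norm (mat 1 + k *\<^sub>R M)"
      using spec_norm_add[of "(1 - h / k) *\<^sub>R mat 1" "(h / k) *\<^sub>R (mat 1 + k *\<^sub>R M)"] that
      by (simp add: spec_norm_scaleR spec_norm_mat_1)
    then have "spec_norm (mat 1 + h *\<^sub>R M) - 1 \<le> (spec_norm (mat 1 + k *\<^sub>R M) - 1) / k * h"
      by (simp add: diff_divide_distrib algebra_simps)
    then show ?thesis using that by (simp add: q_def pos_divide_le_eq)
  qed
  obtain u :: "real ^ 'n" where "norm u = 1"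
    using vector_choose_size[of 1] by auto
  with below[of _ u] have bdd: "bdd_below (q ` {0<..})"
    by (auto intro!: bdd_belowI2)
  have "(q \<longlongrightarrow> (INF h\<in>{0<..}. q h)) (at_right 0)"
  proof (rule order_tendstoI)
    fix a assume "a < (INF h\<in>{0<..}. q h)"
    then have "a < q h" if "0 < h" for h
      using cINF_lower[OF bdd, of h] that by simp
    then show "eventually (\<lambda>h. a < q h) (at_right 0)"
      by (simp add: eventually_at_right_less eventually_mono[OF eventually_at_right_less])
  next
    fix a assume "(INF h\<in>{0<..}. q h) < a"
    then obtain k where "0 < k" "q k < a"
      using cINF_less_iff[OF _ bdd] by auto
    then show "eventually (\<lambda>h. q h < a) (at_right 0)"
      using le_less_trans[OF mono \<open>q k < a\<close>] by (intro eventually_at_rightI[of 0 k]) auto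
  qed
  then have "log_norm2 M = (INF h\<in>{0<..}. q h)"
    unfolding log_norm2_def q_def by (intro tendsto_Lim) auto
  moreover have "x \<bullet> (M *v x) / (norm x)\<^sup>2 \<le> (INF h\<in>{0<..}. q h)" if "x \<noteq> 0"
    using below[of _ x] that by (intro cINF_greatest) (auto simp: field_simps)
  ultimately show ?thesis
    by (cases "x = 0") (auto simp: field_simps)
qed

section \<open>Orthonormal block rows\<close>

lemma transpose_block_row_mult:
  fixes V :: "nat \<Rightarrow> real ^ 'd ^ 'n"
  assumes "orthonormal_block_basis V CARD('m) K"
  shows "transpose (block_row V) ** block_row V
    = (mat 1 :: real ^ ('m::{finite,linorder} \<times> 'd) ^ ('m \<times> 'd))"
proof -
  \<comment> \<open>Numbering the indices by \<open>card {..k}\<close> is injective, so distinct pairs name distinct columns.\<close>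
  have inj: "card {..k} = card {..l} \<longleftrightarrow> k = l" for k l :: 'm
  proof
    assume eq: "card {..k} = card {..l}"
    have "{..k} \<subseteq> {..l} \<or> {..l} \<subseteq> {..k}"
      using linear[of k l] by auto
    with eq have "{..k} = {..l}"
      by (metis card_subset_eq finite)
    then show "k = l" by simp
  qed simp
  have range: "card {..k} \<in> {1..CARD('m)}" for k :: 'm
    by (auto simp: Suc_le_eq card_gt_0_iff intro!: card_mono)
  have column: "column kc (block_row V :: real ^ ('m \<times> 'd) ^ 'n) = column (snd kc) (V (card {..fst kc}))" for kc
    by (simp add: column_def block_row_def vec_eq_iff)
  show ?thesis
    using assms range
    by (auto simp: matrix_mult_transpose_dot_column column orthonormal_block_basis_def mat_def vec_eq_iff inj prod_eq_iff)
qed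

section \<open>The differential Sylvester equation\<close>

text \<open>
  Variation of constants in integrating-factor form: the derivative of
  \<open>s \<mapsto> e\<^bsup>(t-s)A\<^esup> X(s) e\<^bsup>(t-s)B\<^esup>\<close> is \<open>e\<^bsup>(t-s)A\<^esup> C e\<^bsup>(t-s)B\<^esup>\<close>, and this function equals \<open>0\<close> at \<open>t0\<close>
  and \<open>X t\<close> at \<open>t\<close>.
\<close>

lemma differential_sylvester_solution:
  fixes A :: "real ^ 'n ^ 'n" and B :: "real ^ 'p ^ 'p" and C :: "real ^ 'p ^ 'n"
  assumes "t0 \<le> t"
    and X': "\<And>s. s \<in> {t0..t} \<Longrightarrow>
       (X has_vector_derivative (A ** X s + X s ** B + C)) (at s within {t0..t})"
    and "X t0 = 0"
  shows "X t = integral {t0..t} (\<lambda>s. mexp ((t - s) *\<^sub>R A) ** C ** mexp ((t - s) *\<^sub>R B))"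
proof -
  define P where "P s = mexp ((t - s) *\<^sub>R A)" for s
  define Q where "Q s = mexp ((t - s) *\<^sub>R B)" for s
  have comm: "M ** mexp (r *\<^sub>R M) = mexp (r *\<^sub>R M) ** M" for r and M :: "real ^ 'k ^ 'k"
  proof (cases "r = 0")
    case False
    with mexp_commute[of "r *\<^sub>R M"] show ?thesis
      by (simp add: matrix_mult_scaleR_left matrix_mult_scaleR_right)
  qed (simp add: mexp_0)
  have "((\<lambda>s. P s ** X s ** Q s) has_vector_derivative P s ** C ** Q s) (at s within {t0..t})"
    if "s \<in> {t0..t}" for s
  proof -
    note dP = mexp_reverse_has_vector_derivative[of t A s, folded P_def]
    note dQ = mexp_reverse_has_vector_derivative[of t B s, folded Q_def]
    note mult = bounded_bilinear.has_vector_derivative[OF bounded_bilinear_matrix_mult]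
    have "A ** P s = P s ** A" by (simp add: P_def comm)
    then have "P s ** X s ** - (B ** Q s) + (P s ** (A ** X s + X s ** B + C) + - (A ** P s) ** X s) ** Q s
      = P s ** C ** Q s"
      by (simp add: bounded_bilinear.add_left[OF bounded_bilinear_matrix_mult]
         bounded_bilinear.add_right[OF bounded_bilinear_matrix_mult]
         bounded_bilinear.minus_left[OF bounded_bilinear_matrix_mult]
         bounded_bilinear.minus_right[OF bounded_bilinear_matrix_mult] matrix_mul_assoc)
    with mult[OF mult[OF dP X'[OF that]] dQ] show ?thesis by simp
  qed
  from fundamental_theorem_of_calculus[OF \<open>t0 \<le> t\<close> this]
  have "((\<lambda>s. P s ** C ** Q s) has_integral X t) {t0..t}"
    using \<open>X t0 = 0\<close> by (simp add: P_def Q_def mexp_0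
         bounded_bilinear.zero_left[OF bounded_bilinear_matrix_mult]
         bounded_bilinear.zero_right[OF bounded_bilinear_matrix_mult])
  then show ?thesis unfolding P_def Q_def by (rule integral_unique[symmetric])
qed

section \<open>The error bound\<close>

theorem proposition2p6:
  fixes A :: "real ^ 'n ^ 'n" and B :: "real ^ 'p ^ 'p"
    and E :: "real ^ 's ^ 'n" and F :: "real ^ 's ^ 'p"
    and t0 Tf :: real
    and V :: "nat \<Rightarrow> real ^ 'd ^ 'n" and W :: "nat \<Rightarrow> real ^ 'd ^ 'p"
    and X :: "real \<Rightarrow> real ^ 'p ^ 'n"
    and VV :: "real ^ ('m::{finite,linorder} \<times> 'd) ^ 'n"
    and WW :: "real ^ ('m \<times> 'd) ^ 'p"
    and TA TB :: "real ^ ('m \<times> 'd) ^ ('m \<times> 'd)"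
    and Em Fm :: "real ^ 's ^ ('m \<times> 'd)"
    and G :: "real \<Rightarrow> real ^ ('m \<times> 'd) ^ ('m \<times> 'd)"
    and Xm :: "real \<Rightarrow> real ^ 'p ^ 'n"
    and ZA ZmA :: "real \<Rightarrow> real \<Rightarrow> real ^ 's ^ 'n"
    and ZB ZmB :: "real \<Rightarrow> real \<Rightarrow> real ^ 's ^ 'p"
    and \<Gamma>1 \<Gamma>2 :: "real \<Rightarrow> real"
  assumes "t0 < Tf"
    and "full_rank E" and "full_rank F"
    and arnoldi:
      "(CARD('d) = CARD('s) \<and>
        (\<forall>j\<in>{1..CARD('m)}. orthonormal_block_basis V j (block_krylov A E j) \<and>
                           orthonormal_block_basis W j (block_krylov (transpose B) F j)))
     \<or> (CARD('d) = 2 * CARD('s) \<and> invertible A \<and> invertible B \<and>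
        (\<forall>j\<in>{1..CARD('m)}. orthonormal_block_basis V j (ext_block_krylov A E j) \<and>
                           orthonormal_block_basis W j (ext_block_krylov (transpose B) F j)))"
    and VV: "VV = block_row V" and WW: "WW = block_row W"
    and TA: "TA = transpose VV ** A ** VV"
    and TB: "TB = transpose WW ** transpose B ** WW"
    and Em: "Em = transpose VV ** E" and Fm: "Fm = transpose WW ** F"
    and G: "\<And>t. G t = integral {t0..t} (\<lambda>\<tau>.
              mexp ((t - \<tau>) *\<^sub>R TA) ** Em ** transpose Fm ** mexp ((t - \<tau>) *\<^sub>R transpose TB))"
    and X_ode: "\<And>t. t \<in> {t0..Tf} \<Longrightarrow>
              (X has_vector_derivative (A ** X t + X t ** B + E ** transpose F)) (at t within {t0..Tf})"
    and X_init: "X t0 = 0"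
    and Xm: "\<And>t. Xm t = VV ** G t ** transpose WW"
    and ZA: "\<And>t \<tau>. ZA t \<tau> = mexp ((t - \<tau>) *\<^sub>R A) ** E"
    and ZB: "\<And>t \<tau>. ZB t \<tau> = mexp ((t - \<tau>) *\<^sub>R transpose B) ** F"
    and ZmA: "\<And>t \<tau>. ZmA t \<tau> = VV ** mexp ((t - \<tau>) *\<^sub>R TA) ** Em"
    and ZmB: "\<And>t \<tau>. ZmB t \<tau> = WW ** mexp ((t - \<tau>) *\<^sub>R TB) ** Fm"
    and \<Gamma>1: "\<And>t. \<Gamma>1 t = integral {t0..t} (\<lambda>\<tau>. exp (- \<tau> * log_norm2 B) * spec_norm (ZA t \<tau> - ZmA t \<tau>))"
    and \<Gamma>2: "\<And>t. \<Gamma>2 t = integral {t0..t} (\<lambda>\<tau>. exp (- \<tau> * log_norm2 A) * spec_norm (ZB t \<tau> - ZmB t \<tau>))"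
  shows "\<forall>t\<in>{t0..Tf}. spec_norm (X t - Xm t)
           \<le> spec_norm F * exp (t * log_norm2 B) * \<Gamma>1 t
             + spec_norm Em * exp (t * log_norm2 A) * \<Gamma>2 t"
proof
  fix t assume t: "t \<in> {t0..Tf}"
  define \<Delta>A where "\<Delta>A s = ZA t s - ZmA t s" for s
  define \<Delta>B where "\<Delta>B s = ZB t s - ZmB t s" for s
  note mexp_cont = continuous_on_mexp_reverse
  note mult_cont = continuous_on_matrix_mult
  have cont: "continuous_on {t0..t} (ZA t)" "continuous_on {t0..t} (ZmA t)"
      "continuous_on {t0..t} (ZB t)" "continuous_on {t0..t} (ZmB t)"
    unfolding ZA[abs_def] ZmA[abs_def] ZB[abs_def] ZmB[abs_def]
    by (intro mult_cont mexp_cont continuous_on_const)+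
  then have cont\<Delta>: "continuous_on {t0..t} \<Delta>A" "continuous_on {t0..t} \<Delta>B"
    unfolding \<Delta>A_def[abs_def] \<Delta>B_def[abs_def] by (auto intro: continuous_on_diff)
  have VV_orth: "transpose VV ** VV = mat 1"
    using arnoldi unfolding VV by (auto intro: transpose_block_row_mult)

  have X_eq: "X t = integral {t0..t} (\<lambda>s. ZA t s ** transpose (ZB t s))"
  proof -
    have "X t = integral {t0..t}
        (\<lambda>s. mexp ((t - s) *\<^sub>R A) ** (E ** transpose F) ** mexp ((t - s) *\<^sub>R B))"
      using t X_init
      by (intro differential_sylvester_solution has_vector_derivative_within_subset[OF X_ode]) auto
    then show ?thesis
      by (simp add: ZA ZB matrix_transpose_mul mexp_transpose[symmetric] transpose_scalar matrix_mul_assoc)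
  qed
  have Xm_eq: "Xm t = integral {t0..t} (\<lambda>s. ZmA t s ** transpose (ZmB t s))"
  proof -
    let ?g = "\<lambda>s. mexp ((t - s) *\<^sub>R TA) ** Em ** transpose Fm ** mexp ((t - s) *\<^sub>R transpose TB)"
    have bl: "bounded_linear (\<lambda>M. VV ** M ** transpose WW)"
      by (rule bounded_linear_compose[OF bounded_bilinear.bounded_linear_left
            bounded_bilinear.bounded_linear_right]) (rule bounded_bilinear_matrix_mult)+
    have "?g integrable_on {t0..t}"
      by (intro integrable_continuous_real mult_cont mexp_cont continuous_on_const)
    from integral_linear[OF this bl] show ?thesis
      by (simp add: Xm G o_def ZmA ZmB matrix_transpose_mul mexp_transpose[symmetric]
          transpose_scalar matrix_mul_assoc)
  qed
  have split: "X t - Xm t = integral {t0..t}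
      (\<lambda>s. \<Delta>A s ** transpose (ZB t s) + ZmA t s ** transpose (\<Delta>B s))"
  proof -
    have "X t - Xm t = integral {t0..t}
        (\<lambda>s. ZA t s ** transpose (ZB t s) - ZmA t s ** transpose (ZmB t s))"
      unfolding X_eq Xm_eq
      by (intro integral_diff[symmetric] integrable_continuous_real mult_cont continuous_on_transpose cont)
    then show ?thesis
      by (simp add: \<Delta>A_def \<Delta>B_def matrix_mult_diff_left matrix_mult_diff_right
          linear_diff[OF bounded_linear.linear[OF bounded_linear_transpose]])
  qed

  have ZB_le: "spec_norm (transpose (ZB t s)) \<le> exp ((t - s) * log_norm2 B) * spec_norm F"
    if "s \<in> {t0..t}" for s
  proof -
    have "spec_norm (mexp ((t - s) *\<^sub>R transpose B)) \<le> exp ((t - s) * log_norm2 B)"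
      unfolding transpose_scalar[symmetric] mexp_transpose spec_norm_transpose
      using that by (intro spec_norm_mexp_le inner_le_log_norm2) simp
    then show ?thesis
      unfolding spec_norm_transpose ZB
      by (rule order_trans[OF spec_norm_mult mult_right_mono]) (rule spec_norm_nonneg)
  qed
  have ZmA_le: "spec_norm (ZmA t s) \<le> exp ((t - s) * log_norm2 A) * spec_norm Em"
    if "s \<in> {t0..t}" for s
  proof -
    \<comment> \<open>\<open>VV\<close> is isometric, so it drops out of the norm and carries the bound for \<open>A\<close> over to \<open>TA\<close>.\<close>
    have iso: "norm (VV *v y) = norm y" for y
    proof -
      have "(VV *v y) \<bullet> (VV *v y) = ((transpose VV ** VV) *v y) \<bullet> y"
        by (simp only: matrix_vector_mul_assoc[symmetric] inner_transpose_vector)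
      then show ?thesis by (simp add: VV_orth norm_eq_sqrt_inner)
    qed
    have "y \<bullet> (TA *v y) \<le> log_norm2 A * (norm y)\<^sup>2" for y
    proof -
      have "y \<bullet> (TA *v y) = (VV *v y) \<bullet> (A *v (VV *v y))"
        by (simp only: TA matrix_vector_mul_assoc[symmetric] inner_transpose_vector inner_commute[of y])
          (rule inner_commute)
      also have "\<dots> \<le> log_norm2 A * (norm y)\<^sup>2"
        using inner_le_log_norm2[of "VV *v y" A] by (simp add: iso)
      finally show ?thesis .
    qed
    then have "spec_norm (mexp ((t - s) *\<^sub>R TA)) \<le> exp ((t - s) * log_norm2 A)"
      using that by (intro spec_norm_mexp_le) auto
    then have "spec_norm (mexp ((t - s) *\<^sub>R TA) ** Em) \<le> exp ((t - s) * log_norm2 A) * spec_norm Em"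
      by (rule order_trans[OF spec_norm_mult mult_right_mono]) (rule spec_norm_nonneg)
    moreover have "spec_norm (ZmA t s) = spec_norm (mexp ((t - s) *\<^sub>R TA) ** Em)"
    proof -
      have "norm (ZmA t s *v x) = norm ((mexp ((t - s) *\<^sub>R TA) ** Em) *v x)" for x
        unfolding ZmA matrix_mul_assoc[symmetric]
        by (subst matrix_vector_mul_assoc[symmetric]) (rule iso)
      then show ?thesis by (simp add: spec_norm_def onorm_def)
    qed
    ultimately show ?thesis by simp
  qed

  define gA where "gA s = exp (- s * log_norm2 B) * spec_norm (\<Delta>A s)" for s
  define gB where "gB s = exp (- s * log_norm2 A) * spec_norm (\<Delta>B s)" for s
  have contg: "continuous_on {t0..t} gA" "continuous_on {t0..t} gB"
    unfolding gA_def[abs_def] gB_def[abs_def]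
    by (intro continuous_intros continuous_on_spec_norm cont\<Delta>)+
  let ?a = "spec_norm F * exp (t * log_norm2 B)" and ?b = "spec_norm Em * exp (t * log_norm2 A)"
  have "spec_norm (X t - Xm t) \<le> integral {t0..t} (\<lambda>s. ?a * gA s + ?b * gB s)"
    unfolding split
  proof (rule spec_norm_integral_le)
    fix s assume s: "s \<in> {t0..t}"
    have "spec_norm (\<Delta>A s ** transpose (ZB t s))
        \<le> spec_norm (\<Delta>A s) * (exp ((t - s) * log_norm2 B) * spec_norm F)"
      by (rule order_trans[OF spec_norm_mult mult_left_mono[OF ZB_le[OF s] spec_norm_nonneg]])
    also have "\<dots> = ?a * gA s"
      by (simp add: gA_def left_diff_distrib exp_diff exp_minus field_simps)
    finally have 1: "spec_norm (\<Delta>A s ** transpose (ZB t s)) \<le> ?a * gA s" .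
    have "spec_norm (ZmA t s ** transpose (\<Delta>B s))
        \<le> (exp ((t - s) * log_norm2 A) * spec_norm Em) * spec_norm (transpose (\<Delta>B s))"
      by (rule order_trans[OF spec_norm_mult mult_right_mono[OF ZmA_le[OF s] spec_norm_nonneg]])
    also have "\<dots> = ?b * gB s"
      by (simp add: gB_def spec_norm_transpose left_diff_distrib exp_diff exp_minus field_simps)
    finally have 2: "spec_norm (ZmA t s ** transpose (\<Delta>B s)) \<le> ?b * gB s" .
    show "spec_norm (\<Delta>A s ** transpose (ZB t s) + ZmA t s ** transpose (\<Delta>B s))
        \<le> ?a * gA s + ?b * gB s"
      by (rule order_trans[OF spec_norm_add add_mono[OF 1 2]])
  qed (intro continuous_intros mult_cont continuous_on_transpose cont cont\<Delta> contg)+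
  also have "\<dots> = ?a * integral {t0..t} gA + ?b * integral {t0..t} gB"
    using contg by (subst integral_add) (auto intro!: integrable_continuous_real continuous_intros)
  also have "\<dots> = ?a * \<Gamma>1 t + ?b * \<Gamma>2 t"
    by (simp add: \<Gamma>1 \<Gamma>2 gA_def[abs_def] gB_def[abs_def] \<Delta>A_def \<Delta>B_def)
  finally show "spec_norm (X t - Xm t) \<le> ?a * \<Gamma>1 t + ?b * \<Gamma>2 t" .
qed

end
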